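(* Let $E$ be $(\mathbb{C}^n,\|\cdot\|_\infty)$ with $n\ge 2$, or $E=c_0$. Then $\mathcal{B}_{inv}(B_E)\subsetneq\mathcal{B}_{nat}(B_E)$.
   Context: $c_0$ is the complex Banach space of complex null sequences with the sup-norm. For a complex Banach space $E$ with open unit ball $B_E$, $H(B_E)$ is the space of holomorphic (complex Fréchet differentiable) functions $f:B_E\to\mathbb{C}$, and $Aut(B_E)$ is the set of all biholomorphic bijections $\phi:B_E\to B_E$. For $f\in H(B_E)$ put $\|f\|_{nat}=\sup_{x\in B_E}(1-\|x\|^2)\|f'(x)\|$ and $\|f\|_{inv}=\sup_{\phi\in Aut(B_E)}\|(f\circ\phi)'(0)\|$ (derivatives are in $E^*$, with the dual norm). Define $\mathcal{B}_{nat}(B_E)=\{f\in H(B_E):\|f\|_{nat}<\infty\}$ and $\mathcal{B}_{inv}(B_E)=\{f\in H(B_E):\|f\|_{inv}<\infty\}$. *)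

theory Defs
  imports "HOL-Analysis.Analysis"
begin

section \<open>Complex Banach spaces\<close>

class complex_normed_vector = real_normed_vector +
  fixes scaleC :: "complex \<Rightarrow> 'a \<Rightarrow> 'a" (infixr \<open>*\<^sub>C\<close> 75)
  assumes scaleC_add_right: "c *\<^sub>C (x + y) = c *\<^sub>C x + c *\<^sub>C y"
    and scaleC_add_left: "(c + d) *\<^sub>C x = c *\<^sub>C x + d *\<^sub>C x"
    and scaleC_scaleC: "c *\<^sub>C d *\<^sub>C x = (c * d) *\<^sub>C x"
    and scaleC_of_real: "complex_of_real r *\<^sub>C x = r *\<^sub>R x"
    and norm_scaleC: "norm (c *\<^sub>C x) = cmod c * norm x"

class complex_banach = complex_normed_vector + banach

instantiation complex :: complex_banach
begin

definition scaleC_complex :: "complex \<Rightarrow> complex \<Rightarrow> complex" where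
  "scaleC_complex c z = c * z"

instance
  by standard (auto simp: scaleC_complex_def algebra_simps norm_mult scaleR_conv_of_real)

end

section \<open>The space \<open>\<complex>\<^sup>n\<close> with the maximum norm\<close>

text \<open>The dimension is the cardinality of the finite index type. A separate type is needed
  because the library's \<open>complex ^ 'n\<close> carries the Euclidean norm.\<close>

typedef 'n csup = "UNIV :: ('n \<Rightarrow> complex) set"
  morphisms csup_nth Csup ..

setup_lifting type_definition_csup

instantiation csup :: (finite) complex_normed_vector
begin

lift_definition zero_csup :: "'a csup" is "\<lambda>_. 0" .
lift_definition plus_csup :: "'a csup \<Rightarrow> 'a csup \<Rightarrow> 'a csup" is "\<lambda>x y i. x i + y i" .
lift_definition minus_csup :: "'a csup \<Rightarrow> 'a csup \<Rightarrow> 'a csup" is "\<lambda>x y i. x i - y i" .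
lift_definition uminus_csup :: "'a csup \<Rightarrow> 'a csup" is "\<lambda>x i. - x i" .
lift_definition scaleR_csup :: "real \<Rightarrow> 'a csup \<Rightarrow> 'a csup" is "\<lambda>r x i. r *\<^sub>R x i" .
lift_definition scaleC_csup :: "complex \<Rightarrow> 'a csup \<Rightarrow> 'a csup" is "\<lambda>c x i. c * x i" .
lift_definition norm_csup :: "'a csup \<Rightarrow> real" is "\<lambda>x. MAX i. cmod (x i)" .

definition dist_csup :: "'a csup \<Rightarrow> 'a csup \<Rightarrow> real" where
  "dist_csup x y = norm (x - y)"
definition sgn_csup :: "'a csup \<Rightarrow> 'a csup" where
  "sgn_csup x = inverse (norm x) *\<^sub>R x"
definition uniformity_csup :: "('a csup \<times> 'a csup) filter" where
  "uniformity_csup = (INF e\<in>{0<..}. principal {(x, y). dist x y < e})"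
definition open_csup :: "'a csup set \<Rightarrow> bool" where
  "open_csup U \<longleftrightarrow> (\<forall>x\<in>U. \<forall>\<^sub>F (x', y) in uniformity. x' = x \<longrightarrow> y \<in> U)"

lemma csup_le_iff: "norm (x :: 'a csup) \<le> b \<longleftrightarrow> (\<forall>i. cmod (csup_nth x i) \<le> b)"
  by (auto simp: norm_csup.rep_eq)

lemma csup_nth_le_norm: "cmod (csup_nth x i) \<le> norm (x :: 'a csup)"
  using csup_le_iff by blast

lemma csup_norm_scale:
  fixes x y :: "'a csup"
  assumes r: "r \<ge> 0" and xy: "\<And>i. cmod (csup_nth y i) = r * cmod (csup_nth x i)"
  shows "norm y = r * norm x"
proof -
  have "mono (\<lambda>t. r * t)"
    using r by (auto simp: mono_def mult_left_mono)
  then have "r * (MAX i. cmod (csup_nth x i)) = Max ((\<lambda>t. r * t) ` range (\<lambda>i. cmod (csup_nth x i)))"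
    by (intro mono_Max_commute) auto
  then show ?thesis
    by (simp add: norm_csup.rep_eq xy image_image)
qed

instance
proof
  fix x y z :: "'a csup" and a b :: real and c d :: complex
  show "dist x y = norm (x - y)" by (rule dist_csup_def)
  show "sgn x = inverse (norm x) *\<^sub>R x" by (rule sgn_csup_def)
  show "uniformity = (INF e\<in>{0<..}. principal {(x, y :: 'a csup). dist x y < e})"
    by (rule uniformity_csup_def)
  fix U :: "'a csup set"
  show "open U \<longleftrightarrow> (\<forall>x\<in>U. \<forall>\<^sub>F (x', y) in uniformity. x' = x \<longrightarrow> y \<in> U)"
    by (rule open_csup_def)
  have "norm x \<ge> 0"
    by (rule order_trans[OF norm_ge_zero csup_nth_le_norm])
  moreover have "x = 0 \<longleftrightarrow> norm x \<le> 0"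
    unfolding csup_le_iff by transfer auto
  ultimately show "norm x = 0 \<longleftrightarrow> x = 0" by auto
  show "norm (x + y) \<le> norm x + norm y"
    unfolding csup_le_iff plus_csup.rep_eq
    by (intro allI norm_triangle_le add_mono csup_nth_le_norm)
  show "norm (a *\<^sub>R x) = \<bar>a\<bar> * norm x"
    by (rule csup_norm_scale) (auto simp: scaleR_csup.rep_eq)
  show "norm (c *\<^sub>C x) = cmod c * norm x"
    by (rule csup_norm_scale) (auto simp: scaleC_csup.rep_eq norm_mult)
qed (transfer; simp add: fun_eq_iff algebra_simps scaleR_conv_of_real)+

end

instance csup :: (finite) complex_banach
proof
  fix X :: "nat \<Rightarrow> 'a csup"
  assume X: "Cauchy X"
  have "Cauchy (\<lambda>n. csup_nth (X n) i)" for i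
  proof (rule metric_CauchyI)
    fix e :: real assume "e > 0"
    then obtain N where N: "\<forall>m\<ge>N. \<forall>n\<ge>N. dist (X m) (X n) < e"
      using X unfolding Cauchy_def by blast
    have le: "dist (csup_nth (X m) i) (csup_nth (X n) i) \<le> dist (X m) (X n)" for m n
      using csup_nth_le_norm[of "X m - X n" i] unfolding dist_norm minus_csup.rep_eq .
    show "\<exists>N. \<forall>m\<ge>N. \<forall>n\<ge>N. dist (csup_nth (X m) i) (csup_nth (X n) i) < e"
      by (intro exI[of _ N] allI impI le_less_trans[OF le]) (simp add: N)
  qed
  then have "\<forall>i. \<exists>l. (\<lambda>n. csup_nth (X n) i) \<longlonglongrightarrow> l"
    by (simp add: Cauchy_convergent_iff convergent_def)
  then obtain L where L: "\<And>i. (\<lambda>n. csup_nth (X n) i) \<longlonglongrightarrow> L i"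
    by metis
  have "(\<lambda>n. \<Sum>i\<in>UNIV. cmod (csup_nth (X n) i - L i)) \<longlonglongrightarrow> (\<Sum>i\<in>(UNIV::'a set). 0)"
    by (intro tendsto_sum tendsto_norm_zero LIM_zero L)
  then have "(\<lambda>n. \<Sum>i\<in>UNIV. cmod (csup_nth (X n) i - L i)) \<longlonglongrightarrow> 0" by simp
  then have "(\<lambda>n. norm (X n - Csup L)) \<longlonglongrightarrow> 0"
  proof (rule Lim_null_comparison[OF always_eventually, rotated], intro allI)
    fix n
    show "norm (norm (X n - Csup L)) \<le> (\<Sum>i\<in>UNIV. cmod (csup_nth (X n) i - L i))"
      unfolding real_norm_def abs_norm_cancel csup_le_iff minus_csup.rep_eq Csup_inverse[OF UNIV_I]
      by (auto intro!: member_le_sum)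
  qed
  then have "X \<longlonglongrightarrow> Csup L"
    unfolding tendsto_norm_zero_iff LIM_zero_iff .
  then show "convergent X"
    by (rule convergentI)
qed

section \<open>The space \<open>c\<^sub>0\<close> of complex null sequences\<close>

typedef c0 = "{x :: nat \<Rightarrow> complex. x \<longlonglongrightarrow> 0}"
  morphisms c0_nth C0
  by (intro exI[of _ "\<lambda>_. 0"]) auto

setup_lifting type_definition_c0

instantiation c0 :: complex_normed_vector
begin

lift_definition zero_c0 :: c0 is "\<lambda>_. 0" by simp
lift_definition plus_c0 :: "c0 \<Rightarrow> c0 \<Rightarrow> c0" is "\<lambda>x y n. x n + y n"
  by (rule tendsto_add_zero)
lift_definition minus_c0 :: "c0 \<Rightarrow> c0 \<Rightarrow> c0" is "\<lambda>x y n. x n - y n"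
  using tendsto_diff by fastforce
lift_definition uminus_c0 :: "c0 \<Rightarrow> c0" is "\<lambda>x n. - x n"
  using tendsto_minus by fastforce
lift_definition scaleR_c0 :: "real \<Rightarrow> c0 \<Rightarrow> c0" is "\<lambda>r x n. r *\<^sub>R x n"
  using tendsto_scaleR[OF tendsto_const] by fastforce
lift_definition scaleC_c0 :: "complex \<Rightarrow> c0 \<Rightarrow> c0" is "\<lambda>c x n. c * x n"
  by (rule tendsto_mult_right_zero)
lift_definition norm_c0 :: "c0 \<Rightarrow> real" is "\<lambda>x. SUP n. cmod (x n)" .

definition dist_c0 :: "c0 \<Rightarrow> c0 \<Rightarrow> real" where
  "dist_c0 x y = norm (x - y)"
definition sgn_c0 :: "c0 \<Rightarrow> c0" where
  "sgn_c0 x = inverse (norm x) *\<^sub>R x"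
definition uniformity_c0 :: "(c0 \<times> c0) filter" where
  "uniformity_c0 = (INF e\<in>{0<..}. principal {(x, y). dist x y < e})"
definition open_c0 :: "c0 set \<Rightarrow> bool" where
  "open_c0 U \<longleftrightarrow> (\<forall>x\<in>U. \<forall>\<^sub>F (x', y) in uniformity. x' = x \<longrightarrow> y \<in> U)"

lemma c0_bdd_above: "bdd_above (range (\<lambda>n. cmod (c0_nth x n)))"
proof -
  have "Bseq (c0_nth x)"
    using c0_nth[of x] by (auto intro!: convergent_imp_Bseq simp: convergent_def)
  then show ?thesis by (auto simp: Bseq_def bdd_above_def)
qed

lemma c0_nth_le_norm: "cmod (c0_nth x n) \<le> norm x"
  unfolding norm_c0.rep_eq by (rule cSUP_upper[OF UNIV_I c0_bdd_above])

lemma c0_le_iff: "norm (x :: c0) \<le> b \<longleftrightarrow> (\<forall>n. cmod (c0_nth x n) \<le> b)"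
proof
  show "\<forall>n. cmod (c0_nth x n) \<le> b" if "norm x \<le> b"
    using that by (auto intro: order_trans[OF c0_nth_le_norm])
qed (auto simp: norm_c0.rep_eq intro: cSUP_least)

lemma c0_norm_scale_le:
  fixes x y :: c0
  assumes "r \<ge> 0" and "\<And>n. cmod (c0_nth y n) = r * cmod (c0_nth x n)"
  shows "norm y \<le> r * norm x"
  using assms by (auto simp: c0_le_iff intro: mult_left_mono c0_nth_le_norm)

lemma c0_norm_scale:
  fixes x y :: c0
  assumes r: "r \<ge> 0" and xy: "\<And>n. cmod (c0_nth y n) = r * cmod (c0_nth x n)"
  shows "norm y = r * norm x"
proof (cases "r = 0")
  case True
  then show ?thesis
    using xy by (simp add: norm_c0.rep_eq)
next
  case False
  then have "norm x \<le> inverse r * norm y"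
    using r xy by (intro c0_norm_scale_le) (auto simp: field_simps)
  then have "r * norm x \<le> norm y"
    using False r by (simp add: field_simps)
  then show ?thesis
    using c0_norm_scale_le[OF r xy] by linarith
qed

instance
proof
  fix x y z :: c0 and a b :: real and c d :: complex
  show "dist x y = norm (x - y)" by (rule dist_c0_def)
  show "sgn x = inverse (norm x) *\<^sub>R x" by (rule sgn_c0_def)
  show "uniformity = (INF e\<in>{0<..}. principal {(x, y :: c0). dist x y < e})"
    by (rule uniformity_c0_def)
  fix U :: "c0 set"
  show "open U \<longleftrightarrow> (\<forall>x\<in>U. \<forall>\<^sub>F (x', y) in uniformity. x' = x \<longrightarrow> y \<in> U)"
    by (rule open_c0_def)
  have "norm x \<ge> 0"
    by (rule order_trans[OF norm_ge_zero c0_nth_le_norm])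
  moreover have "x = 0 \<longleftrightarrow> norm x \<le> 0"
    unfolding c0_le_iff by transfer auto
  ultimately show "norm x = 0 \<longleftrightarrow> x = 0" by auto
  show "norm (x + y) \<le> norm x + norm y"
    unfolding c0_le_iff plus_c0.rep_eq
    by (intro allI norm_triangle_le add_mono c0_nth_le_norm)
  show "norm (a *\<^sub>R x) = \<bar>a\<bar> * norm x"
    by (rule c0_norm_scale) (auto simp: scaleR_c0.rep_eq)
  show "norm (c *\<^sub>C x) = cmod c * norm x"
    by (rule c0_norm_scale) (auto simp: scaleC_c0.rep_eq norm_mult)
qed (transfer; simp add: fun_eq_iff algebra_simps scaleR_conv_of_real)+

end

instance c0 :: complex_banach
proof
  fix X :: "nat \<Rightarrow> c0"
  assume X: "Cauchy X"
  have unif: "\<exists>N. \<forall>m\<ge>N. \<forall>n\<ge>N. \<forall>i. cmod (c0_nth (X m) i - c0_nth (X n) i) < e" if e: "e > 0" for e :: real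
  proof -
    obtain N where N: "\<forall>m\<ge>N. \<forall>n\<ge>N. dist (X m) (X n) < e"
      using X e unfolding Cauchy_def by blast
    have le: "cmod (c0_nth (X m) i - c0_nth (X n) i) \<le> dist (X m) (X n)" for m n i
      using c0_nth_le_norm[of "X m - X n" i] unfolding dist_norm minus_c0.rep_eq .
    show ?thesis
      by (intro exI[of _ N] allI impI le_less_trans[OF le]) (simp add: N)
  qed
  have "Cauchy (\<lambda>n. c0_nth (X n) i)" for i
  proof (rule metric_CauchyI)
    fix e :: real assume "e > 0"
    from unif[OF this] show "\<exists>N. \<forall>m\<ge>N. \<forall>n\<ge>N. dist (c0_nth (X m) i) (c0_nth (X n) i) < e"
      unfolding dist_norm by (elim ex_forward) simp
  qed
  then have "\<forall>i. \<exists>l. (\<lambda>n. c0_nth (X n) i) \<longlonglongrightarrow> l"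
    by (simp add: Cauchy_convergent_iff convergent_def)
  then obtain L where L: "\<And>i. (\<lambda>n. c0_nth (X n) i) \<longlonglongrightarrow> L i"
    by metis
  have lim: "\<exists>N. \<forall>m\<ge>N. \<forall>i. cmod (c0_nth (X m) i - L i) \<le> e" if e: "e > 0" for e :: real
  proof -
    obtain N where N: "\<forall>m\<ge>N. \<forall>n\<ge>N. \<forall>i. cmod (c0_nth (X m) i - c0_nth (X n) i) < e"
      using unif[OF e] by blast
    have "cmod (c0_nth (X m) i - L i) \<le> e" if "m \<ge> N" for m i
    proof (rule tendsto_upperbound)
      show "(\<lambda>n. cmod (c0_nth (X m) i - c0_nth (X n) i)) \<longlonglongrightarrow> cmod (c0_nth (X m) i - L i)"
        by (intro tendsto_intros L)
      show "\<forall>\<^sub>F n in sequentially. cmod (c0_nth (X m) i - c0_nth (X n) i) \<le> e"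
        using N that unfolding eventually_sequentially
          by (intro exI[of _ N]) (simp add: less_imp_le)
    qed simp
    then show ?thesis by blast
  qed
  have "L \<longlonglongrightarrow> 0"
  proof (rule LIMSEQ_I)
    fix e :: real assume "e > 0"
    then obtain m where "\<forall>i. cmod (c0_nth (X m) i - L i) \<le> e / 2"
      using lim[of "e / 2"] half_gt_zero by blast
    then have m: "\<And>i. cmod (c0_nth (X m) i - L i) \<le> e / 2" by simp
    have "c0_nth (X m) \<longlonglongrightarrow> 0"
      using c0_nth by blast
    then obtain K where K: "\<forall>i\<ge>K. cmod (c0_nth (X m) i) < e / 2"
      using \<open>e > 0\<close> LIMSEQ_D[of "c0_nth (X m)" 0 "e / 2"] by auto
    have "cmod (L i) < e" if "i \<ge> K" for i
      using m[of i] K[rule_format, OF that]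
        norm_triangle_ineq4[of "c0_nth (X m) i" "c0_nth (X m) i - L i"] by simp
    then show "\<exists>K. \<forall>i\<ge>K. cmod (L i - 0) < e" by auto
  qed
  then have nth: "c0_nth (C0 L) = L" by (simp add: C0_inverse)
  have "X \<longlonglongrightarrow> C0 L"
  proof (rule LIMSEQ_I)
    fix e :: real assume "e > 0"
    then obtain N where "\<forall>m\<ge>N. \<forall>i. cmod (c0_nth (X m) i - L i) \<le> e / 2"
      using lim[of "e / 2"] half_gt_zero by blast
    then have "\<forall>m\<ge>N. norm (X m - C0 L) \<le> e / 2"
      unfolding c0_le_iff minus_c0.rep_eq nth .
    moreover have "e / 2 < e" using \<open>e > 0\<close> by simp
    ultimately show "\<exists>N. \<forall>m\<ge>N. norm (X m - C0 L) < e"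
      by (intro exI[of _ N]) (auto intro: le_less_trans)
  qed
  then show "convergent X" by (auto simp: convergent_def)
qed

section \<open>Holomorphic functions and Bloch spaces on the unit ball\<close>

text \<open>Complex Frechet differentiability at every point of a set (used for open sets only):
  the real Frechet derivative exists and is complex linear.\<close>

definition cholomorphic_on ::
    "('a::complex_banach \<Rightarrow> 'b::complex_banach) \<Rightarrow> 'a set \<Rightarrow> bool" (infix \<open>cholomorphic'_on\<close> 50) where
  "f cholomorphic_on S \<longleftrightarrow>
     (\<forall>x\<in>S. \<exists>D. (f has_derivative D) (at x) \<and> (\<forall>c v. D (c *\<^sub>C v) = c *\<^sub>C D v))"

text \<open>As with \<open>holomorphic_on\<close> in the library, maps defined on the ball are represented by total
  functions whose values off the ball are irrelevant. The ball being open, derivatives at its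
  points do not depend on those values.\<close>

definition hol_ball :: "('a::complex_banach \<Rightarrow> complex) set" where
  "hol_ball = {f. f cholomorphic_on ball 0 1}"

definition Aut_ball :: "('a::complex_banach \<Rightarrow> 'a) set" where
  "Aut_ball = {\<phi>. bij_betw \<phi> (ball 0 1) (ball 0 1) \<and> \<phi> cholomorphic_on ball 0 1 \<and>
                  the_inv_into (ball 0 1) \<phi> cholomorphic_on ball 0 1}"

text \<open>The suprema are taken in the extended nonnegative reals. The operator norm of a
  complex-linear functional over the reals agrees with its complex dual norm.\<close>

definition bloch_norm_nat :: "('a::complex_banach \<Rightarrow> complex) \<Rightarrow> ennreal" where
  "bloch_norm_nat f =
     (SUP x\<in>ball 0 1. ennreal ((1 - (norm x)\<^sup>2) * onorm (frechet_derivative f (at x))))"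

definition bloch_norm_inv :: "('a::complex_banach \<Rightarrow> complex) \<Rightarrow> ennreal" where
  "bloch_norm_inv f =
     (SUP \<phi>\<in>Aut_ball. ennreal (onorm (frechet_derivative (f \<circ> \<phi>) (at 0))))"

definition Bloch_nat :: "('a::complex_banach \<Rightarrow> complex) set" where
  "Bloch_nat = {f \<in> hol_ball. bloch_norm_nat f < \<infinity>}"

definition Bloch_inv :: "('a::complex_banach \<Rightarrow> complex) set" where
  "Bloch_inv = {f \<in> hol_ball. bloch_norm_inv f < \<infinity>}"

end

theory Submission
  imports Defs
begin

text \<open>For \<open>a\<close> in the ball, the coordinatewise Moebius map
  \<open>y \<mapsto> ((a\<^sub>i + y\<^sub>i) / (1 + cnj a\<^sub>i y\<^sub>i))\<^sub>i\<close> is an automorphism of the ball that takes \<open>0\<close> to \<open>a\<close> and whose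
  derivative at \<open>0\<close> is the diagonal map with entries \<open>1 - \<bar>a\<^sub>i\<bar>\<^sup>2 \<ge> 1 - \<parallel>a\<parallel>\<^sup>2\<close>; this gives
  \<open>\<parallel>f\<parallel>\<^sub>n\<^sub>a\<^sub>t \<le> \<parallel>f\<parallel>\<^sub>i\<^sub>n\<^sub>v\<close>. For strictness take \<open>f x = - x\<^sub>j Ln (1 - x\<^sub>i)\<close> with \<open>i \<noteq> j\<close>: the logarithm is a
  Bloch function, so \<open>\<parallel>f\<parallel>\<^sub>n\<^sub>a\<^sub>t\<close> is finite, but at \<open>a = t e\<^sub>i\<close> the diagonal entry of index \<open>j\<close>
  is \<open>1\<close>, so \<open>\<parallel>f\<parallel>\<^sub>i\<^sub>n\<^sub>v \<ge> - ln (1 - t)\<close> for all \<open>0 < t < 1\<close>.\<close>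

section \<open>Moebius maps of the unit disc, with bounds uniform in the parameter\<close>

definition disc_mob :: "complex \<Rightarrow> complex \<Rightarrow> complex" where
  "disc_mob a z = (a + z) / (1 + cnj a * z)"

text \<open>Reverse triangle inequality. A bound \<open>r\<close> stands in place of
  \<open>cmod a\<close> so that the single value \<open>norm a\<close> can later serve all
  coordinates at once.\<close>

lemma disc_mob_denom_ge:
  assumes "cmod a \<le> r" "cmod z \<le> 1"
  shows "1 - r \<le> cmod (1 + cnj a * z)"
proof -
  have "cmod (cnj a * z) \<le> r * 1"
    unfolding norm_mult using assms by (intro mult_mono) (auto intro: order_trans[OF norm_ge_zero])
  then show ?thesis
    using norm_triangle_ineq4[of "1 + cnj a * z" "cnj a * z"] by simp
qed

lemma disc_mob_denom_nonzero:
  assumes "cmod a < 1" "cmod z \<le> 1"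
  shows "1 + cnj a * z \<noteq> 0"
  using disc_mob_denom_ge[OF order_refl assms(2), of a] assms(1) by auto

text \<open>Rests on |1 + cnj a z|^2 - |a + z|^2 = (1 - |a|^2)(1 - |z|^2) together with |1 + cnj a
  z| <= 2. The bound is below 1 and depends only on \<open>r\<close> and \<open>s\<close>, so it
  survives a supremum over coordinates.\<close>

lemma disc_mob_norm_le:
  assumes "cmod a \<le> r" "r < 1" "cmod z \<le> s" "s < 1"
  shows "cmod (disc_mob a z) \<le> sqrt (1 - (1 - r\<^sup>2) * (1 - s\<^sup>2) / 4)"
proof (rule real_le_rsqrt)
  let ?d = "1 + cnj a * z"
  have r: "0 \<le> r" and s: "0 \<le> s"
    using assms norm_ge_zero order_trans by blast+
  have d0: "?d \<noteq> 0"
    using assms by (intro disc_mob_denom_nonzero) auto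
  have "cmod (cnj a * z) \<le> 1 * 1"
    unfolding norm_mult using assms by (intro mult_mono) auto
  then have "cmod ?d \<le> 2"
    using norm_triangle_ineq[of 1 "cnj a * z"] by simp
  then have d4: "(cmod ?d)\<^sup>2 \<le> 4"
    using power_mono[of "cmod ?d" 2 2] by simp
  have rs: "(1 - r\<^sup>2) * (1 - s\<^sup>2) \<le> (1 - (cmod a)\<^sup>2) * (1 - (cmod z)\<^sup>2)"
    using assms r s by (intro mult_mono) (auto simp: power_mono power_le_one)
  have nn: "0 \<le> (1 - r\<^sup>2) * (1 - s\<^sup>2)"
    using assms r s by (simp add: power_le_one)
  have "(1 - r\<^sup>2) * (1 - s\<^sup>2) / 4 * (cmod ?d)\<^sup>2 \<le> (1 - r\<^sup>2) * (1 - s\<^sup>2) / 4 * 4"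
    using d4 nn by (intro mult_left_mono) auto
  then have "(1 - r\<^sup>2) * (1 - s\<^sup>2) / 4 * (cmod ?d)\<^sup>2 \<le> (1 - r\<^sup>2) * (1 - s\<^sup>2)" by simp
  moreover have "(cmod ?d)\<^sup>2 - (cmod (a + z))\<^sup>2 = (1 - (cmod a)\<^sup>2) * (1 - (cmod z)\<^sup>2)"
    unfolding cmod_power2 by (simp add: algebra_simps power2_eq_square)
  ultimately have "(cmod (a + z))\<^sup>2 \<le> (1 - (1 - r\<^sup>2) * (1 - s\<^sup>2) / 4) * (cmod ?d)\<^sup>2"
    using rs by (simp add: algebra_simps)
  then show "(cmod (disc_mob a z))\<^sup>2 \<le> 1 - (1 - r\<^sup>2) * (1 - s\<^sup>2) / 4"
    using d0 by (simp add: disc_mob_def norm_divide power_divide pos_divide_le_eq)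
qed

lemma disc_mob_inverse:
  assumes "cmod a < 1" "cmod z \<le> 1"
  shows "disc_mob (- a) (disc_mob a z) = z"
proof -
  have d: "1 + cnj a * z \<noteq> 0"
    using assms by (rule disc_mob_denom_nonzero)
  have e: "1 - cnj a * a \<noteq> 0"
    using disc_mob_denom_nonzero[of a "- a"] assms by simp
  have "- a + disc_mob a z = (1 - cnj a * a) * z / (1 + cnj a * z)"
    and "1 + cnj (- a) * disc_mob a z = (1 - cnj a * a) / (1 + cnj a * z)"
    using d by (simp_all add: disc_mob_def field_simps)
  then show ?thesis
    unfolding disc_mob_def[of "- a"] using d e by simp
qed

definition disc_mob_deriv :: "complex \<Rightarrow> complex \<Rightarrow> complex" where
  "disc_mob_deriv a z = (1 - cnj a * a) / (1 + cnj a * z)\<^sup>2"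

lemma cmod_one_minus_le_1:
  assumes "cmod a < 1"
  shows "cmod (1 - cnj a * a) \<le> 1"
proof -
  have "1 - cnj a * a = complex_of_real (1 - (cmod a)\<^sup>2)"
    by (simp add: complex_norm_square[unfolded mult.commute[of _ "cnj _"]] del: of_real_power)
  then have "cmod (1 - cnj a * a) = \<bar>1 - (cmod a)\<^sup>2\<bar>"
    by (metis norm_of_real)
  then show ?thesis
    using assms power_le_one[of "cmod a" 2] by simp
qed

lemma disc_mob_deriv_norm_le:
  assumes "cmod a \<le> r" "r < 1" "cmod z \<le> 1"
  shows "cmod (disc_mob_deriv a z) \<le> 1 / (1 - r)\<^sup>2"
  unfolding disc_mob_deriv_def norm_divide norm_power
  using assms cmod_one_minus_le_1[of a] disc_mob_denom_ge[of a r z]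
  by (intro frac_le power_mono) auto

text \<open>The first-order Taylor remainder has a closed form with the factor
  \<open>h\<^sup>2\<close>. Its constant depends only on \<open>r\<close>, which lets the
  coordinatewise expansions combine into a Frechet derivative for the sup-norm.\<close>

lemma disc_mob_remainder_le:
  assumes "cmod a \<le> r" "r < 1" "cmod z \<le> 1" "cmod (z + h) \<le> 1"
  shows "cmod (disc_mob a (z + h) - disc_mob a z - disc_mob_deriv a z * h) \<le> (cmod h)\<^sup>2 / (1 - r) ^ 3"
proof -
  let ?d = "1 + cnj a * z" and ?e = "1 + cnj a * (z + h)"
  have d: "?d \<noteq> 0" and e: "?e \<noteq> 0"
    using assms by (simp_all add: disc_mob_denom_nonzero)
  have "(disc_mob a (z + h) - disc_mob a z - disc_mob_deriv a z * h) * (?d\<^sup>2 * ?e)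
     = (a + (z + h)) * ?d\<^sup>2 - (a + z) * (?d * ?e) - (1 - cnj a * a) * (h * ?e)"
  proof -
    \<comment> \<open>Fractions are cleared with the two denominators as opaque variables, so that
      they are not expanded.\<close>
    have "(p / y - q / x - k / x\<^sup>2 * h) * (x\<^sup>2 * y) = p * x\<^sup>2 - q * (x * y) - k * (h * y)"
      if "x \<noteq> 0" "y \<noteq> 0" for p q k x y :: complex
      using that by (simp add: field_simps power2_eq_square)
    from this[OF d e] show ?thesis
      unfolding disc_mob_def disc_mob_deriv_def .
  qed
  also have "\<dots> = - (1 - cnj a * a) * cnj a * h\<^sup>2"
    by (simp add: power2_eq_square algebra_simps)
  finally have eq: "disc_mob a (z + h) - disc_mob a z - disc_mob_deriv a z * h
      = - (1 - cnj a * a) * cnj a * h\<^sup>2 / (?d\<^sup>2 * ?e)"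
    using d e by (simp add: eq_divide_eq)
  have "(1 - r)\<^sup>2 * (1 - r) \<le> (cmod ?d)\<^sup>2 * cmod ?e"
    using assms by (intro mult_mono power_mono disc_mob_denom_ge) auto
  moreover have "cmod (1 - cnj a * a) * cmod a * (cmod h)\<^sup>2 \<le> 1 * 1 * (cmod h)\<^sup>2"
    using assms cmod_one_minus_le_1[of a] by (intro mult_mono) auto
  ultimately show ?thesis
    unfolding eq norm_divide norm_mult norm_power norm_minus_cancel complex_mod_cnj power3_eq_cube
    using assms by (intro frac_le) (auto simp: power2_eq_square)
qed

text \<open>Common setting for both spaces of the theorem. Solidity is the substitute for a
  description of which families are coordinates of a vector: it turns coordinatewise formulas into
  elements of the space once they are dominated. \<open>ex_unit\<close> supplies the unit vectors
  for the strictness part.\<close>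

locale solid_sup_space =
  fixes coord :: "'a::complex_banach \<Rightarrow> 'i \<Rightarrow> complex"
  assumes coord_add: "coord (x + y) i = coord x i + coord y i"
    and coord_scaleC: "coord (c *\<^sub>C x) i = c * coord x i"
    and norm_le_iff: "norm x \<le> b \<longleftrightarrow> (\<forall>i. cmod (coord x i) \<le> b)"
    and ex_unit: "\<exists>u. \<forall>k. coord u k = (if k = i then 1 else 0)"
    and solid: "(\<And>i. cmod (w i) \<le> cmod (coord x i)) \<Longrightarrow> \<exists>z. \<forall>i. coord z i = w i"
begin

section \<open>Coordinate functionals and diagonal operators\<close>

lemma coord_scaleR: "coord (r *\<^sub>R x) i = r *\<^sub>R coord x i"
  using coord_scaleC[of "complex_of_real r"] by (simp add: scaleC_of_real scaleR_conv_of_real)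

lemma coord_bounded_linear: "bounded_linear (\<lambda>x. coord x i)"
proof (rule bounded_linear_intro[where K = 1])
  show "norm (coord x i) \<le> norm x * 1" for x
    using norm_le_iff[of x "norm x"] by simp
qed (simp_all add: coord_add coord_scaleR)

lemma coord_minus: "coord (- x) i = - coord x i"
  and coord_diff: "coord (x - y) i = coord x i - coord y i"
  and coord_zero: "coord 0 i = 0"
  using linear_neg[OF bounded_linear.linear[OF coord_bounded_linear]]
    linear_diff[OF bounded_linear.linear[OF coord_bounded_linear]]
    linear_0[OF bounded_linear.linear[OF coord_bounded_linear]]
  by blast+

lemma coord_le_norm: "cmod (coord x i) \<le> norm x"
  using norm_le_iff by blast

lemma coord_eqI:
  assumes "\<And>i. coord x i = coord y i"
  shows "x = y"
proof -
  have "norm (x - y) \<le> 0"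
    unfolding norm_le_iff by (simp add: assms coord_diff)
  then show ?thesis by simp
qed

text \<open>Solidity applied to the multiple of \<open>x\<close> by the absolute value of
  \<open>K\<close>, which avoids a sign condition on \<open>K\<close>.\<close>

lemma ex_coord_bounded_mult:
  assumes "\<And>i. cmod (w i) \<le> K * cmod (coord x i)"
  shows "\<exists>z. \<forall>i. coord z i = w i"
proof (rule solid)
  fix i
  have "K * cmod (coord x i) \<le> \<bar>K\<bar> * cmod (coord x i)"
    by (intro mult_right_mono) auto
  then show "cmod (w i) \<le> cmod (coord (complex_of_real \<bar>K\<bar> *\<^sub>C x) i)"
    using assms[of i] by (simp add: coord_scaleC norm_mult)
qed

text \<open>Choice makes the operator total; its value is meaningful where a vector with these
  coordinates exists, as it does for bounded \<open>m\<close>.\<close>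

definition diag :: "('i \<Rightarrow> complex) \<Rightarrow> 'a \<Rightarrow> 'a" where
  "diag m x = (SOME z. \<forall>i. coord z i = m i * coord x i)"

lemma coord_diag:
  assumes "\<And>i. cmod (m i) \<le> K"
  shows "coord (diag m x) i = m i * coord x i"
proof -
  have "\<exists>z. \<forall>i. coord z i = m i * coord x i"
    using assms by (intro ex_coord_bounded_mult[of _ K x]) (auto simp: norm_mult intro: mult_right_mono)
  from someI_ex[OF this] show ?thesis
    unfolding diag_def by blast
qed

lemma diag_bounded_linear:
  assumes K: "\<And>i. cmod (m i) \<le> K"
  shows "bounded_linear (diag m)"
proof (rule bounded_linear_intro[where K = K])
  show "norm (diag m x) \<le> norm x * K" for x
    unfolding norm_le_iff coord_diag[OF K] norm_mult
    using K by (subst mult.commute) (auto intro!: mult_mono coord_le_norm)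
qed (auto intro!: coord_eqI simp: coord_diag[OF K] coord_add coord_scaleR algebra_simps)

section \<open>Coordinatewise Moebius maps as automorphisms of the ball\<close>

definition mob :: "'a \<Rightarrow> 'a \<Rightarrow> 'a" where
  "mob a y = (SOME z. \<forall>i. coord z i = disc_mob (coord a i) (coord y i))"

text \<open>Existence of the chosen vector: the denominators are at least \<open>1 - norm a\<close>,
  so the coordinates are dominated by a multiple of |a_i| + |y_i|, and solidity puts both families
  of moduli into the space.\<close>

lemma coord_mob:
  assumes a: "norm a < 1" and y: "norm y \<le> 1"
  shows "coord (mob a y) i = disc_mob (coord a i) (coord y i)"
proof -
  obtain a' where a': "\<And>i. coord a' i = complex_of_real (cmod (coord a i))"
    using solid[of "\<lambda>i. complex_of_real (cmod (coord a i))" a] by auto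
  obtain y' where y': "\<And>i. coord y' i = complex_of_real (cmod (coord y i))"
    using solid[of "\<lambda>i. complex_of_real (cmod (coord y i))" y] by auto
  have "cmod (disc_mob (coord a i) (coord y i)) \<le> 1 / (1 - norm a) * cmod (coord (a' + y') i)" for i
  proof -
    have "1 - norm a \<le> cmod (1 + cnj (coord a i) * coord y i)"
      using y by (intro disc_mob_denom_ge coord_le_norm order_trans[OF coord_le_norm])
    moreover have "cmod (coord (a' + y') i) = cmod (coord a i) + cmod (coord y i)"
      unfolding coord_add a' y' of_real_add[symmetric] norm_of_real by simp
    ultimately show ?thesis
      unfolding disc_mob_def norm_divide using a norm_triangle_ineq[of "coord a i" "coord y i"]
      by (auto intro!: frac_le)
  qed
  from ex_coord_bounded_mult[OF this] have "\<exists>z. \<forall>i. coord z i = disc_mob (coord a i) (coord y i)" .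
  from someI_ex[OF this] show ?thesis
    unfolding mob_def by blast
qed

text \<open>One bound below 1 is valid for all coordinates. Having each coordinate below 1 would not
  by itself keep a supremum over infinitely many of them below 1.\<close>

lemma mob_in_ball:
  assumes a: "norm a < 1" and y: "norm y < 1"
  shows "norm (mob a y) < 1"
proof -
  let ?c = "(1 - (norm a)\<^sup>2) * (1 - (norm y)\<^sup>2) / 4"
  have "norm (mob a y) \<le> sqrt (1 - ?c)"
    unfolding norm_le_iff using assms
    by (auto simp: coord_mob intro!: disc_mob_norm_le coord_le_norm)
  also have "?c > 0"
    using assms by (auto simp: power_less_one_iff abs_square_less_1)
  then have "sqrt (1 - ?c) < 1" by simp
  finally show ?thesis .
qed

lemma mob_inverse:
  assumes a: "norm a < 1" and y: "norm y < 1"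
  shows "mob (- a) (mob a y) = y"
proof (rule coord_eqI)
  fix i
  have "cmod (coord a i) < 1" "cmod (coord y i) \<le> 1"
    using assms by (auto intro: le_less_trans[OF coord_le_norm] order_trans[OF coord_le_norm])
  then show "coord (mob (- a) (mob a y)) i = coord y i"
    using assms mob_in_ball[OF assms] by (simp add: coord_mob coord_minus disc_mob_inverse)
qed

abbreviation mob_deriv :: "'a \<Rightarrow> 'a \<Rightarrow> 'a \<Rightarrow> 'a" where
  "mob_deriv a y \<equiv> diag (\<lambda>i. disc_mob_deriv (coord a i) (coord y i))"

lemma disc_mob_deriv_coord_le:
  assumes "norm a < 1" "norm y \<le> 1"
  shows "cmod (disc_mob_deriv (coord a i) (coord y i)) \<le> 1 / (1 - norm a)\<^sup>2"
  using assms by (intro disc_mob_deriv_norm_le coord_le_norm order_trans[OF coord_le_norm])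

text \<open>By the uniform quadratic remainder, the difference quotient error is at most a constant
  times \<open>norm (x - y)\<close>. The radius \<open>1 - norm y\<close> keeps \<open>x\<close>
  inside the ball.\<close>

lemma mob_has_derivative:
  assumes a: "norm a < 1" and y: "norm y < 1"
  shows "(mob a has_derivative mob_deriv a y) (at y)"
proof (rule has_derivativeI_sandwich[where e = "1 - norm y"])
  let ?D = "mob_deriv a y"
  note K = disc_mob_deriv_coord_le[OF a less_imp_le[OF y]]
  show "0 < 1 - norm y" using y by simp
  show "bounded_linear ?D" by (rule diag_bounded_linear[OF K])
  show "norm (mob a x - mob a y - ?D (x - y)) / norm (x - y) \<le> norm (x - y) / (1 - norm a) ^ 3"
    if "x \<noteq> y" "dist x y < 1 - norm y" for x
  proof -
    have x: "norm x < 1"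
      using that norm_triangle_ineq2[of x y] by (simp add: dist_norm)
    have "norm (mob a x - mob a y - ?D (x - y)) \<le> (norm (x - y))\<^sup>2 / (1 - norm a) ^ 3"
      unfolding norm_le_iff
    proof
      fix i
      have "cmod (coord (mob a x - mob a y - ?D (x - y)) i) \<le> (cmod (coord (x - y) i))\<^sup>2 / (1 - norm a) ^ 3"
        using disc_mob_remainder_le[of "coord a i" "norm a" "coord y i" "coord (x - y) i"]
          a x y order_trans[OF coord_le_norm, of x 1 i] order_trans[OF coord_le_norm, of y 1 i]
        by (simp add: coord_diff coord_mob coord_diag[OF K] coord_le_norm)
      also have "\<dots> \<le> (norm (x - y))\<^sup>2 / (1 - norm a) ^ 3"
        using a by (intro divide_right_mono power_mono coord_le_norm) auto
      finally show "cmod (coord (mob a x - mob a y - ?D (x - y)) i) \<le> (norm (x - y))\<^sup>2 / (1 - norm a) ^ 3" .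
    qed
    then show ?thesis
      using that by (simp add: pos_divide_le_eq power2_eq_square)
  qed
  have "((\<lambda>x. norm (x - y) / (1 - norm a) ^ 3) \<longlongrightarrow> norm (y - y) / (1 - norm a) ^ 3) (at y)"
    using a by (intro tendsto_intros) auto
  then show "((\<lambda>x. norm (x - y) / (1 - norm a) ^ 3) \<longlongrightarrow> 0) (at y)" by simp
qed

lemma mob_cholomorphic:
  assumes a: "norm a < 1"
  shows "mob a cholomorphic_on ball 0 1"
  unfolding cholomorphic_on_def
proof
  fix y :: 'a assume "y \<in> ball 0 1"
  then have y: "norm y < 1" by simp
  have "mob_deriv a y (c *\<^sub>C v) = c *\<^sub>C mob_deriv a y v" for c v
    by (rule coord_eqI)
      (simp add: coord_diag[OF disc_mob_deriv_coord_le[OF a less_imp_le[OF y]]] coord_scaleC)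
  then show "\<exists>D. (mob a has_derivative D) (at y) \<and> (\<forall>c v. D (c *\<^sub>C v) = c *\<^sub>C D v)"
    using mob_has_derivative[OF a y] by blast
qed

text \<open>The inverse on the ball is \<open>mob (- a)\<close>, which is a map of the same kind and
  hence holomorphic.\<close>

lemma mob_in_Aut_ball:
  assumes a: "norm a < 1"
  shows "mob a \<in> Aut_ball"
proof -
  have inv1: "mob (- a) (mob a y) = y" if "y \<in> ball 0 1" for y
    using mob_inverse[OF a] that by simp
  have inv2: "mob a (mob (- a) y) = y" if "y \<in> ball 0 1" for y
    using mob_inverse[of "- a" y] a that by simp
  have maps: "mob a ` ball 0 1 \<subseteq> ball 0 1" "mob (- a) ` ball 0 1 \<subseteq> ball 0 1"
    using mob_in_ball a by auto
  have bij: "bij_betw (mob a) (ball 0 1) (ball 0 1)"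
    by (rule bij_betw_byWitness[where f' = "mob (- a)"]) (use inv1 inv2 maps in auto)
  have eq: "the_inv_into (ball 0 1) (mob a) y = mob (- a) y" if "y \<in> ball 0 1" for y
    using bij inv2[OF that] subsetD[OF maps(2) imageI[OF that]]
    unfolding bij_betw_def by (intro the_inv_into_f_eq) blast+
  have "the_inv_into (ball 0 1) (mob a) cholomorphic_on ball 0 1"
    unfolding cholomorphic_on_def
  proof
    fix y :: 'a assume y: "y \<in> ball 0 1"
    have "norm (- a) < 1" using a by simp
    then obtain D where D: "(mob (- a) has_derivative D) (at y)" "\<forall>c v. D (c *\<^sub>C v) = c *\<^sub>C D v"
      using mob_cholomorphic y unfolding cholomorphic_on_def by blast
    \<comment> \<open>The two inverses are known to agree only on the ball; its openness suffices to
      transfer the derivative.\<close>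
    have "(the_inv_into (ball 0 1) (mob a) has_derivative D) (at y)"
      using has_derivative_transform_within_open[OF D(1) open_ball y] eq by metis
    then show "\<exists>D. (the_inv_into (ball 0 1) (mob a) has_derivative D) (at y) \<and>
        (\<forall>c v. D (c *\<^sub>C v) = c *\<^sub>C D v)"
      using D(2) by blast
  qed
  then show ?thesis
    using bij mob_cholomorphic[OF a] by (simp add: Aut_ball_def)
qed

lemma mob_0:
  assumes "norm a < 1"
  shows "mob a 0 = a"
  by (rule coord_eqI) (simp add: coord_mob assms coord_zero disc_mob_def)

section \<open>Comparison of the two Bloch seminorms\<close>

lemma comp_mob_has_derivative:
  assumes a: "norm a < 1" and D: "(f has_derivative D) (at a)"
  shows "((f \<circ> mob a) has_derivative D \<circ> mob_deriv a 0) (at 0)"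
  using D by (intro diff_chain_at mob_has_derivative) (simp_all add: a mob_0)

lemma bloch_norm_inv_ge:
  fixes f :: "'a \<Rightarrow> complex"
  assumes a: "norm a < 1" and D: "(f has_derivative D) (at a)"
  shows "ennreal (onorm (D \<circ> mob_deriv a 0)) \<le> bloch_norm_inv f"
  unfolding bloch_norm_inv_def
  using frechet_derivative_at[OF comp_mob_has_derivative[OF assms]]
  by (intro SUP_upper2[OF mob_in_Aut_ball[OF a]]) simp

text \<open>With s = 1 - |a|^2 and E the derivative of \<open>mob a\<close> at 0, all diagonal
  entries of E are at least s. Thus s times the inverse of E is a contraction, and s D factors as (D
  o E) followed after that contraction.\<close>

lemma onorm_le_onorm_comp_mob_deriv:
  fixes D :: "'a \<Rightarrow> complex"
  assumes a: "norm a < 1" and D: "bounded_linear D"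
  shows "(1 - (norm a)\<^sup>2) * onorm D \<le> onorm (D \<circ> mob_deriv a 0)"
proof -
  let ?s = "1 - (norm a)\<^sup>2" and ?E = "mob_deriv a 0"
  note K = disc_mob_deriv_coord_le[OF a, of 0, simplified]
  have s: "0 < ?s" using a by (simp add: power_less_one_iff abs_square_less_1)
  have DE: "bounded_linear (D \<circ> ?E)"
    using bounded_linear_compose[OF D diag_bounded_linear[of _ "1 / (1 - norm a)\<^sup>2"]] K
    by (simp add: o_def)
  have "norm (D w) \<le> onorm (D \<circ> ?E) / ?s * norm w" for w
  proof -
    \<comment> \<open>The diagonal of s times the inverse of E, with entries in (0, 1].\<close>
    define m where "m i = complex_of_real (?s / (1 - (cmod (coord a i))\<^sup>2))" for i
    have pos: "?s \<le> 1 - (cmod (coord a i))\<^sup>2" for i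
      using power_mono[OF coord_le_norm[of a i], of 2] by simp
    have m: "cmod (m i) \<le> 1" for i
      unfolding m_def norm_of_real using less_le_trans[OF s pos[of i]] s pos[of i]
      by (simp only: abs_of_pos divide_pos_pos divide_le_eq_1_pos)
    have E: "?E (diag m w) = ?s *\<^sub>R w"
    proof (rule coord_eqI)
      fix i
      have "1 - cnj (coord a i) * coord a i = complex_of_real (1 - (cmod (coord a i))\<^sup>2)"
        by (simp add: complex_norm_square[unfolded mult.commute[of _ "cnj _"]] del: of_real_power)
      then have "disc_mob_deriv (coord a i) 0 * m i
          = complex_of_real ((1 - (cmod (coord a i))\<^sup>2) * (?s / (1 - (cmod (coord a i))\<^sup>2)))"
        unfolding disc_mob_deriv_def m_def of_real_mult by simp
      also have "(1 - (cmod (coord a i))\<^sup>2) * (?s / (1 - (cmod (coord a i))\<^sup>2)) = ?s"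
        using less_imp_neq[OF less_le_trans[OF s pos[of i]]]
        by (metis times_divide_eq_right nonzero_mult_div_cancel_left)
      finally have "disc_mob_deriv (coord a i) 0 * m i = complex_of_real ?s" .
      then show "coord (?E (diag m w)) i = coord (?s *\<^sub>R w) i"
        using K by (simp add: coord_diag[where K = "1 / (1 - norm a)\<^sup>2"] coord_diag[OF m]
            coord_zero coord_scaleR scaleR_conv_of_real)
    qed
    have "norm (diag m w) \<le> norm w"
      unfolding norm_le_iff coord_diag[OF m] norm_mult
      using mult_mono[OF m coord_le_norm] by simp
    have "?s * norm (D w) = norm ((D \<circ> ?E) (diag m w))"
      using s D by (simp add: E linear_simps)
    also have "\<dots> \<le> onorm (D \<circ> ?E) * norm (diag m w)"
      by (rule onorm[OF DE])
    also have "\<dots> \<le> onorm (D \<circ> ?E) * norm w"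
      using \<open>norm (diag m w) \<le> norm w\<close> by (intro mult_left_mono onorm_pos_le DE)
    finally show ?thesis
      using s by (simp add: field_simps)
  qed
  then have "onorm D \<le> onorm (D \<circ> ?E) / ?s"
    using s by (intro onorm_bound divide_nonneg_pos onorm_pos_le DE)
  then show ?thesis
    using s by (simp add: field_simps)
qed

lemma bloch_norm_nat_le_inv:
  fixes f :: "'a \<Rightarrow> complex"
  assumes "f \<in> hol_ball"
  shows "bloch_norm_nat f \<le> bloch_norm_inv f"
  unfolding bloch_norm_nat_def
proof (rule SUP_least)
  fix x :: 'a assume "x \<in> ball 0 1"
  then obtain D where x: "norm x < 1" and D: "(f has_derivative D) (at x)"
    using assms unfolding hol_ball_def cholomorphic_on_def by force
  have "(1 - (norm x)\<^sup>2) * onorm D \<le> onorm (D \<circ> mob_deriv x 0)"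
    using x has_derivative_bounded_linear[OF D] by (rule onorm_le_onorm_comp_mob_deriv)
  then show "ennreal ((1 - (norm x)\<^sup>2) * onorm (frechet_derivative f (at x))) \<le> bloch_norm_inv f"
    using order_trans[OF ennreal_leI bloch_norm_inv_ge[OF x D]] frechet_derivative_at[OF D] by simp
qed

section \<open>The logarithmic function that separates the two spaces\<close>

definition log_witness :: "'i \<Rightarrow> 'i \<Rightarrow> 'a \<Rightarrow> complex" where
  "log_witness i j x = - coord x j * Ln (1 - coord x i)"

definition log_witness_deriv :: "'i \<Rightarrow> 'i \<Rightarrow> 'a \<Rightarrow> 'a \<Rightarrow> complex" where
  "log_witness_deriv i j x v =
     coord x j * (coord v i / (1 - coord x i)) - coord v j * Ln (1 - coord x i)"

text \<open>Keeps the argument of \<open>Ln\<close> off zero and off the branch cut along the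
  negative real axis.\<close>

lemma Re_one_minus_coord_pos:
  assumes "norm x < 1"
  shows "0 < Re (1 - coord x i)"
  using assms complex_Re_le_cmod[of "coord x i"] coord_le_norm[of x i] by simp

lemma log_witness_has_derivative:
  assumes x: "norm x < 1"
  shows "(log_witness i j has_derivative log_witness_deriv i j x) (at x)"
proof -
  note c = bounded_linear.has_derivative[OF coord_bounded_linear has_derivative_ident]
  have "1 - coord x i \<notin> \<real>\<^sub>\<le>\<^sub>0"
    using Re_one_minus_coord_pos[OF x, of i] by (auto simp: complex_nonpos_Reals_iff)
  then have "(Ln has_derivative (*) (inverse (1 - coord x i))) (at (1 - coord x i))"
    using has_field_derivative_Ln unfolding has_field_derivative_def by blast
  from has_derivative_compose[OF has_derivative_diff[OF has_derivative_const c] this]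
  have L: "((\<lambda>x. Ln (1 - coord x i)) has_derivative
      (\<lambda>v. inverse (1 - coord x i) * (0 - coord v i))) (at x)" .
  show ?thesis
    unfolding log_witness_def[abs_def] log_witness_deriv_def[abs_def]
    by (rule has_derivative_eq_rhs[OF has_derivative_mult[OF has_derivative_minus[OF c] L]])
      (auto simp: field_simps)
qed

lemma log_witness_hol_ball: "log_witness i j \<in> hol_ball"
  unfolding hol_ball_def cholomorphic_on_def mem_Collect_eq
proof
  fix x :: 'a assume "x \<in> ball 0 1"
  then have "norm x < 1" by simp
  moreover have "log_witness_deriv i j x (c *\<^sub>C v) = c *\<^sub>C log_witness_deriv i j x v" for c v
    by (simp add: log_witness_deriv_def coord_scaleC scaleC_complex_def algebra_simps)
  ultimately show "\<exists>D. (log_witness i j has_derivative D) (at x) \<and> (\<forall>c v. D (c *\<^sub>C v) = c *\<^sub>C D v)"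
    using log_witness_has_derivative by blast
qed

text \<open>The real part is controlled by ln t <= t - 1 at t = |u| and t = 1/|u|, the imaginary
  part by pi. This crude growth is enough, because the weight \<open>1 - (norm x)\<^sup>2\<close>
  absorbs one factor \<open>1 / (1 - norm x)\<close>.\<close>

lemma cmod_Ln_one_minus_coord_le:
  assumes x: "norm x < 1"
  shows "cmod (Ln (1 - coord x i)) \<le> 1 / (1 - norm x) + 1 + pi"
proof -
  let ?u = "1 - coord x i"
  have u0: "?u \<noteq> 0" using Re_one_minus_coord_pos[OF x, of i] by auto
  have lo: "1 - norm x \<le> cmod ?u"
    using norm_triangle_ineq2[of 1 "coord x i"] coord_le_norm[of x i] by simp
  have hi: "cmod ?u \<le> 2"
    using norm_triangle_ineq4[of 1 "coord x i"] coord_le_norm[of x i] x by simp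
  have "ln (cmod ?u) \<le> 1"
    using ln_le_minus_one[of "cmod ?u"] u0 hi by simp
  moreover have "- ln (cmod ?u) \<le> 1 / (1 - norm x)"
  proof -
    have "- ln (cmod ?u) = ln (1 / cmod ?u)"
      using u0 by (simp add: ln_div)
    also have "\<dots> \<le> 1 / cmod ?u"
      using ln_le_minus_one[of "1 / cmod ?u"] u0 by simp
    also have "\<dots> \<le> 1 / (1 - norm x)"
      using lo x by (intro frac_le) auto
    finally show ?thesis .
  qed
  moreover have "0 < 1 / (1 - norm x)" using x by simp
  ultimately have "\<bar>Re (Ln ?u)\<bar> \<le> 1 / (1 - norm x) + 1"
    using Re_Ln[OF u0] by linarith
  moreover have "\<bar>Im (Ln ?u)\<bar> \<le> pi"
    using mpi_less_Im_Ln[OF u0] Im_Ln_le_pi[OF u0] by (simp add: abs_le_iff)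
  ultimately show ?thesis
    using cmod_le[of "Ln ?u"] by linarith
qed

lemma onorm_log_witness_deriv_le:
  assumes x: "norm x < 1"
  shows "(1 - (norm x)\<^sup>2) * onorm (log_witness_deriv i j x) \<le> 5 + pi"
proof -
  let ?q = "1 / (1 - norm x)"
  have "norm (log_witness_deriv i j x v) \<le> (?q + (?q + 1 + pi)) * norm v" for v
  proof -
    have "1 - norm x \<le> cmod (1 - coord x i)"
      using norm_triangle_ineq2[of 1 "coord x i"] coord_le_norm[of x i] by simp
    then have "cmod (coord x j) * (cmod (coord v i) / cmod (1 - coord x i)) \<le> 1 * (norm v / (1 - norm x))"
      using x order_trans[OF coord_le_norm less_imp_le[OF x]]
      by (intro mult_mono frac_le coord_le_norm) auto
    moreover have "cmod (coord v j) * cmod (Ln (1 - coord x i)) \<le> norm v * (?q + 1 + pi)"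
      by (intro mult_mono coord_le_norm cmod_Ln_one_minus_coord_le[OF x]) auto
    moreover have "1 * (norm v / (1 - norm x)) + norm v * (?q + 1 + pi) = (?q + (?q + 1 + pi)) * norm v"
      by (simp add: algebra_simps)
    ultimately show ?thesis
      using norm_triangle_ineq4[of "coord x j * (coord v i / (1 - coord x i))" "coord v j * Ln (1 - coord x i)"]
      unfolding log_witness_deriv_def norm_mult norm_divide by linarith
  qed
  then have "onorm (log_witness_deriv i j x) \<le> 2 * ?q + 1 + pi"
    using x onorm_bound[of "?q + (?q + 1 + pi)" "log_witness_deriv i j x"] by (simp add: add_nonneg_nonneg)
  then have "(1 - (norm x)\<^sup>2) * onorm (log_witness_deriv i j x) \<le> (1 - (norm x)\<^sup>2) * (2 * ?q + 1 + pi)"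
    using x by (intro mult_left_mono) (auto simp: power_le_one)
  \<comment> \<open>The weight factors as (1 - |x|)(1 + |x|), which cancels the pole in
    \<open>?q\<close>.\<close>
  also have "\<dots> = 2 * (1 + norm x) + (1 - (norm x)\<^sup>2) * (1 + pi)"
    using x by (simp add: power2_eq_square field_simps)
  also have "\<dots> \<le> 2 * (1 + 1) + 1 * (1 + pi)"
    using x by (intro add_mono mult_left_mono mult_right_mono) auto
  finally show ?thesis by simp
qed

lemma log_witness_in_Bloch_nat: "log_witness i j \<in> Bloch_nat"
proof -
  have "bloch_norm_nat (log_witness i j) \<le> ennreal (5 + pi)"
    unfolding bloch_norm_nat_def
    using onorm_log_witness_deriv_le frechet_derivative_at[OF log_witness_has_derivative]
    by (intro SUP_least ennreal_leI) (auto simp: dist_norm)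
  also have "\<dots> < \<infinity>" by simp
  finally show ?thesis
    using log_witness_hol_ball by (simp add: Bloch_nat_def)
qed

text \<open>Tests the automorphism \<open>mob a\<close> on the unit vector \<open>q\<close> of index
  \<open>j\<close>. Since the coordinate of \<open>a\<close> at \<open>j\<close> vanishes,
  \<open>q\<close> passes through the derivative unshrunk and meets the full logarithm.\<close>

lemma bloch_norm_inv_log_witness_ge:
  assumes ij: "i \<noteq> j" and B: "0 < B"
  shows "ennreal B \<le> bloch_norm_inv (log_witness i j)"
proof -
  obtain p where p: "\<And>k. coord p k = (if k = i then 1 else 0)"
    using ex_unit by blast
  obtain q where q: "\<And>k. coord q k = (if k = j then 1 else 0)"
    using ex_unit by blast
  \<comment> \<open>Chosen so that 1 - a_i = exp (- B), whose logarithm is exactly - B.\<close>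
  define a where "a = complex_of_real (1 - exp (- B)) *\<^sub>C p"
  have ca: "coord a k = (if k = i then complex_of_real (1 - exp (- B)) else 0)" for k
    by (simp add: a_def coord_scaleC p)
  have t: "0 < exp (- B)" "exp (- B) < 1" using B by auto
  have "norm a \<le> 1 - exp (- B)"
    unfolding norm_le_iff ca using t by (auto simp del: of_real_diff)
  then have a: "norm a < 1" using t by linarith
  note K = disc_mob_deriv_coord_le[OF a, of 0, simplified]
  let ?D = "log_witness_deriv i j a"
  have D: "(log_witness i j has_derivative ?D) (at a)"
    by (rule log_witness_has_derivative[OF a])
  have DE: "bounded_linear (?D \<circ> mob_deriv a 0)"
    by (rule has_derivative_bounded_linear[OF comp_mob_has_derivative[OF a D]])
  have "mob_deriv a 0 q = q"
    using K ij by (intro coord_eqI)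
      (simp add: coord_diag[where K = "1 / (1 - norm a)\<^sup>2"] q ca coord_zero disc_mob_deriv_def)
  \<comment> \<open>The term containing the coordinate of \<open>q\<close> at \<open>i\<close> drops
    out because \<open>i\<close> and \<open>j\<close> differ; the minus sign in front of
    \<open>Ln\<close> makes the rest equal to B.\<close>
  moreover have "?D q = complex_of_real B"
    using ij by (simp add: log_witness_deriv_def q ca Ln_of_real[symmetric] exp_of_real[symmetric])
  ultimately have "norm ((?D \<circ> mob_deriv a 0) q) = B"
    using B by simp
  moreover have "norm q \<le> 1"
    by (simp add: norm_le_iff q)
  ultimately have "B \<le> onorm (?D \<circ> mob_deriv a 0)"
    using onorm[OF DE, of q] mult_left_mono[OF _ onorm_pos_le[OF DE], of "norm q" 1] by linarith
  then show ?thesis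
    using bloch_norm_inv_ge[OF a D] by (meson ennreal_leI order_trans)
qed

theorem Bloch_inv_psubset_nat:
  assumes "i \<noteq> (j :: 'i)"
  shows "(Bloch_inv :: ('a \<Rightarrow> complex) set) \<subset> Bloch_nat"
proof (rule psubsetI)
  show "(Bloch_inv :: ('a \<Rightarrow> complex) set) \<subseteq> Bloch_nat"
    using bloch_norm_nat_le_inv by (auto simp: Bloch_inv_def Bloch_nat_def intro: le_less_trans)
  have "bloch_norm_inv (log_witness i j) = \<infinity>"
  proof (rule ccontr)
    assume "bloch_norm_inv (log_witness i j) \<noteq> \<infinity>"
    then obtain r where r: "bloch_norm_inv (log_witness i j) = ennreal r" "0 \<le> r"
      by (cases "bloch_norm_inv (log_witness i j)") auto
    \<comment> \<open>\<open>r + 1\<close> is positive, as the lower bound demands, and exceeds the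
      supposed finite value.\<close>
    then have "ennreal (r + 1) \<le> ennreal r"
      using bloch_norm_inv_log_witness_ge[OF assms, of "r + 1"] by simp
    then show False
      using r(2) by simp
  qed
  then have "log_witness i j \<notin> Bloch_inv"
    by (simp add: Bloch_inv_def)
  then show "(Bloch_inv :: ('a \<Rightarrow> complex) set) \<noteq> Bloch_nat"
    using log_witness_in_Bloch_nat by blast
qed

end

section \<open>The two concrete spaces\<close>

interpretation csup: solid_sup_space "csup_nth :: 'n::finite csup \<Rightarrow> 'n \<Rightarrow> complex"
proof
  show "\<exists>u. \<forall>k. csup_nth u k = (if k = i then 1 else 0)" for i :: 'n
    by (intro exI[of _ "Csup (\<lambda>k. if k = i then 1 else 0)"]) (simp add: Csup_inverse)
  show "\<exists>z. \<forall>i. csup_nth z i = w i" for w :: "'n \<Rightarrow> complex"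
    by (intro exI[of _ "Csup w"]) (simp add: Csup_inverse)
qed (simp_all add: plus_csup.rep_eq scaleC_csup.rep_eq csup_le_iff)

text \<open>Solidity is the comparison test: a sequence dominated by a null sequence is
  null.\<close>

interpretation c0: solid_sup_space c0_nth
proof
  show "\<exists>u. \<forall>k. c0_nth u k = (if k = i then 1 else 0)" for i
  proof -
    have "(\<lambda>k. if k = i then 1 else 0 :: complex) \<longlonglongrightarrow> 0"
      by (rule tendsto_eventually) (auto simp: eventually_sequentially intro!: exI[of _ "Suc i"])
    then show ?thesis
      by (intro exI[of _ "C0 (\<lambda>k. if k = i then 1 else 0)"]) (simp add: C0_inverse)
  qed
  show "\<exists>z. \<forall>i. c0_nth z i = w i" if "\<And>i. cmod (w i) \<le> cmod (c0_nth x i)" for w x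
  proof -
    have "w \<longlonglongrightarrow> 0"
      using that c0_nth[of x]
      by (intro Lim_null_comparison[OF _ tendsto_norm_zero, of w "c0_nth x"]) simp_all
    then show ?thesis
      by (intro exI[of _ "C0 w"]) (simp add: C0_inverse)
  qed
qed (simp_all add: plus_c0.rep_eq scaleC_c0.rep_eq c0_le_iff)

theorem corollary2p6:
  "(CARD('n::finite) \<ge> 2 \<longrightarrow> (Bloch_inv :: ('n csup \<Rightarrow> complex) set) \<subset> Bloch_nat) \<and>
   (Bloch_inv :: (c0 \<Rightarrow> complex) set) \<subset> Bloch_nat"
proof (intro conjI impI)
  assume "CARD('n) \<ge> 2"
  then obtain i j :: 'n where "i \<noteq> j"
    using card_le_Suc0_iff_eq[of "UNIV :: 'n set"] by auto
  then show "(Bloch_inv :: ('n csup \<Rightarrow> complex) set) \<subset> Bloch_nat"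
    by (rule csup.Bloch_inv_psubset_nat)
next
  show "(Bloch_inv :: (c0 \<Rightarrow> complex) set) \<subset> Bloch_nat"
    by (rule c0.Bloch_inv_psubset_nat[of 0 1]) simp
qed

end
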